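(* If $S$ is a finite semigroup of order $n\ge 5$, then the upper non-nilpotent graph $\mathcal{N}_S$ is not (isomorphic to) $C_n$, the cycle graph on $n$ vertices.
   Context: For a semigroup $S$, $S^1$ denotes $S$ if $S$ has an identity, and otherwise $S$ with an identity $1$ adjoined. For $x,y\in S$ and $z_1,z_2,\ldots\in S^1$ define recursively $\lambda_0=x$, $\rho_0=y$, $\lambda_{n+1}=\lambda_n z_{n+1}\rho_n$, $\rho_{n+1}=\rho_n z_{n+1}\lambda_n$; write $\lambda_n(x,y,z_1,\ldots,z_n)$, $\rho_n(x,y,z_1,\ldots,z_n)$. A semigroup $S$ is nilpotent (in the sense of Malcev) if there is a positive integer $n$ with $\lambda_n(a,b,c_1,\ldots,c_n)=\rho_n(a,b,c_1,\ldots,c_n)$ for all $a,b\in S$, $c_1,\ldots,c_n\in S^1$. The upper non-nilpotent graph $\mathcal{N}_S$ has vertex set $S$, with distinct $x,y$ adjacent iff the subsemigroup $\langle x,y\rangle$ is not nilpotent. *)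

theory Defs
  imports "Graph_Theory.Graph_Theory"
begin

text \<open>
  The class \<open>semigroup_mult\<close> ties the carrier to a type, whereas subsemigroups have to be
  treated as semigroups in their own right; hence an explicit carrier.
\<close>

locale semigroup_on =
  fixes S :: "'a set" and f :: "'a \<Rightarrow> 'a \<Rightarrow> 'a"
  assumes closed: "x \<in> S \<Longrightarrow> y \<in> S \<Longrightarrow> f x y \<in> S"
    and assoc: "x \<in> S \<Longrightarrow> y \<in> S \<Longrightarrow> z \<in> S \<Longrightarrow> f (f x y) z = f x (f y z)"

inductive_set gen_subsemigroup :: "('a \<Rightarrow> 'a \<Rightarrow> 'a) \<Rightarrow> 'a set \<Rightarrow> 'a set"
  for f :: "'a \<Rightarrow> 'a \<Rightarrow> 'a" and A :: "'a set" where
  incl: "x \<in> A \<Longrightarrow> x \<in> gen_subsemigroup f A"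
| mult: "x \<in> gen_subsemigroup f A \<Longrightarrow> y \<in> gen_subsemigroup f A \<Longrightarrow> f x y \<in> gen_subsemigroup f A"

definition has_identity :: "'a set \<Rightarrow> ('a \<Rightarrow> 'a \<Rightarrow> 'a) \<Rightarrow> bool" where
  "has_identity S f \<longleftrightarrow> (\<exists>e\<in>S. \<forall>x\<in>S. f e x = x \<and> f x e = x)"

text \<open>
  \<open>S\<^sup>1\<close> lives in the option type: \<open>S\<close> is embedded by \<open>Some\<close>, and \<open>None\<close> is the adjoined identity,
  which belongs to the carrier only if \<open>S\<close> has no identity of its own.
\<close>

definition S1_carrier :: "'a set \<Rightarrow> ('a \<Rightarrow> 'a \<Rightarrow> 'a) \<Rightarrow> 'a option set" where
  "S1_carrier S f = (if has_identity S f then Some ` S else insert None (Some ` S))"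

fun S1_mult :: "('a \<Rightarrow> 'a \<Rightarrow> 'a) \<Rightarrow> 'a option \<Rightarrow> 'a option \<Rightarrow> 'a option" where
  "S1_mult f None v = v"
| "S1_mult f u None = u"
| "S1_mult f (Some a) (Some b) = Some (f a b)"

text \<open>Only \<open>z 1, \<dots>, z n\<close> matter in the \<open>n\<close>-th terms; \<open>z 0\<close> is never used.\<close>

fun malcev_lambda malcev_rho ::
    "('b \<Rightarrow> 'b \<Rightarrow> 'b) \<Rightarrow> nat \<Rightarrow> 'b \<Rightarrow> 'b \<Rightarrow> (nat \<Rightarrow> 'b) \<Rightarrow> 'b" where
  "malcev_lambda m 0 x y z = x"
| "malcev_rho m 0 x y z = y"
| "malcev_lambda m (Suc n) x y z =
     m (m (malcev_lambda m n x y z) (z (Suc n))) (malcev_rho m n x y z)"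
| "malcev_rho m (Suc n) x y z =
     m (m (malcev_rho m n x y z) (z (Suc n))) (malcev_lambda m n x y z)"

definition malcev_nilpotent :: "'a set \<Rightarrow> ('a \<Rightarrow> 'a \<Rightarrow> 'a) \<Rightarrow> bool" where
  "malcev_nilpotent S f \<longleftrightarrow>
     (\<exists>n\<ge>1. \<forall>a\<in>S. \<forall>b\<in>S. \<forall>c. (\<forall>i\<in>{1..n}. c i \<in> S1_carrier S f) \<longrightarrow>
        malcev_lambda (S1_mult f) n (Some a) (Some b) c =
        malcev_rho (S1_mult f) n (Some a) (Some b) c)"

text \<open>
  As usual in \<open>Graph_Theory\<close>, a simple undirected graph is a symmetric loop-free digraph:
  an edge between \<open>x\<close> and \<open>y\<close> is the pair of arcs \<open>(x, y)\<close> and \<open>(y, x)\<close>.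
\<close>

definition upper_non_nilpotent_graph :: "'a set \<Rightarrow> ('a \<Rightarrow> 'a \<Rightarrow> 'a) \<Rightarrow> 'a pair_pre_digraph" where
  "upper_non_nilpotent_graph S f =
     \<lparr> pverts = S,
       parcs = {(x, y). x \<in> S \<and> y \<in> S \<and> x \<noteq> y \<and>
                  \<not> malcev_nilpotent (gen_subsemigroup f {x, y}) f} \<rparr>"

text \<open>This is the cycle graph for \<open>n \<ge> 3\<close>.\<close>

definition cycle_graph :: "nat \<Rightarrow> nat pair_pre_digraph" where
  "cycle_graph n =
     \<lparr> pverts = {0..<n},
       parcs = {(i, j). i < n \<and> j < n \<and> (j = (i + 1) mod n \<or> i = (j + 1) mod n)} \<rparr>"

lemma pair_graph_upper_non_nilpotent_graph:
  assumes "finite S"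
  shows "pair_graph (upper_non_nilpotent_graph S f)"
proof -
  have "finite (parcs (upper_non_nilpotent_graph S f))"
    by (rule finite_subset[of _ "S \<times> S"]) (use assms in \<open>auto simp: upper_non_nilpotent_graph_def\<close>)
  with assms show ?thesis
    by unfold_locales
       (auto simp: upper_non_nilpotent_graph_def symmetric_def sym_def insert_commute)
qed

lemma pair_graph_cycle_graph:
  assumes "n \<ge> 3"
  shows "pair_graph (cycle_graph n)"
proof -
  have "finite (parcs (cycle_graph n))"
    by (rule finite_subset[of _ "{0..<n} \<times> {0..<n}"]) (auto simp: cycle_graph_def)
  moreover have no_loop: "Suc i mod n \<noteq> i" if "i < n" for i
    using that assms by (cases "Suc i = n") auto
  ultimately show ?thesis
    by unfold_locales
       (auto simp: cycle_graph_def symmetric_def sym_def dest: no_loop no_loop[symmetric])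
qed

lemma digraph_iso_with_proj_iff:
  assumes "pair_wf_digraph G" and "pair_wf_digraph H"
  shows "digraph_iso (with_proj G) (with_proj H) \<longleftrightarrow>
    (\<exists>g. bij_betw g (pverts G) (pverts H) \<and>
      (\<forall>x\<in>pverts G. \<forall>y\<in>pverts G. (x, y) \<in> parcs G \<longleftrightarrow> (g x, g y) \<in> parcs H))"
    (is "?L \<longleftrightarrow> (\<exists>g. ?P g)")
proof
  interpret G: pair_wf_digraph G by fact
  assume ?L
  then obtain h where h: "pre_digraph.digraph_isomorphism (with_proj G) h"
    and H: "with_proj H = app_iso h (with_proj G)"
    unfolding digraph_iso_def by blast
  let ?g = "iso_verts h"
  have inj: "inj_on ?g (pverts G)"
    and arcs: "\<And>a. a \<in> parcs G \<Longrightarrow>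
      ?g (fst a) = iso_tail h (iso_arcs h a) \<and> ?g (snd a) = iso_head h (iso_arcs h a)"
    using h unfolding pre_digraph.digraph_isomorphism_def by auto
  have eqs: "pverts H = ?g ` pverts G" "parcs H = iso_arcs h ` parcs G"
    "iso_tail h = fst" "iso_head h = snd"
    using H by (auto simp: with_proj_def app_iso_def)
  have arc: "iso_arcs h (x, y) = (?g x, ?g y)" if "(x, y) \<in> parcs G" for x y
    using arcs[OF that] by (auto simp: eqs prod_eq_iff)
  have "(x, y) \<in> parcs G"
    if xy: "x \<in> pverts G" "y \<in> pverts G" "(?g x, ?g y) \<in> parcs H" for x y
  proof -
    obtain u v where uv: "(u, v) \<in> parcs G" "iso_arcs h (u, v) = (?g x, ?g y)"
      using xy(3) unfolding eqs by force
    have "?g u = ?g x" "?g v = ?g y" "u \<in> pverts G" "v \<in> pverts G"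
      using arc[OF uv(1)] uv G.in_arcsD1 G.in_arcsD2 by auto
    with uv xy inj show ?thesis by (metis inj_onD)
  qed
  moreover have "(?g x, ?g y) \<in> parcs H" if "(x, y) \<in> parcs G" for x y
    using arc[OF that] that unfolding eqs by (metis imageI)
  ultimately have "?P ?g" using inj unfolding bij_betw_def eqs(1) by blast
  then show "\<exists>g. ?P g" by blast
next
  interpret G: pair_wf_digraph G by fact
  interpret H: pair_wf_digraph H by fact
  assume "\<exists>g. ?P g"
  then obtain g where inj: "inj_on g (pverts G)" and im: "g ` pverts G = pverts H"
    and adj: "\<And>x y. x \<in> pverts G \<Longrightarrow> y \<in> pverts G \<Longrightarrow>
      (x, y) \<in> parcs G \<longleftrightarrow> (g x, g y) \<in> parcs H"
    unfolding bij_betw_def by blast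
  let ?h = "\<lparr>iso_verts = g, iso_arcs = map_prod g g, iso_head = snd, iso_tail = fst\<rparr>"
  have "inj_on (map_prod g g) (parcs G)"
    by (intro inj_on_subset[OF map_prod_inj_on[OF inj inj]])
       (auto dest: G.in_arcsD1 G.in_arcsD2)
  then have "pre_digraph.digraph_isomorphism (with_proj G) ?h"
    using inj G.wf_digraph unfolding pre_digraph.digraph_isomorphism_def by auto
  moreover have "parcs H = map_prod g g ` parcs G"
  proof (intro set_eqI iffI)
    fix a assume a: "a \<in> parcs H"
    obtain c d where cd: "a = (c, d)" by force
    with a have "c \<in> g ` pverts G" "d \<in> g ` pverts G"
      unfolding im using H.in_arcsD1 H.in_arcsD2 by auto
    then obtain x y where "x \<in> pverts G" "y \<in> pverts G" "a = (g x, g y)"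
      using cd by auto
    with a adj show "a \<in> map_prod g g ` parcs G" by (metis image_eqI map_prod_simp)
  next
    fix a assume "a \<in> map_prod g g ` parcs G"
    then obtain x y where xy: "(x, y) \<in> parcs G" and a: "a = (g x, g y)"
      by (metis imageE map_prod_simp surj_pair)
    show "a \<in> parcs H"
      unfolding a using adj[OF G.in_arcsD1[OF xy] G.in_arcsD2[OF xy]] xy by blast
  qed
  then have "with_proj H = app_iso ?h (with_proj G)"
    using im by (simp add: with_proj_def app_iso_def)
  ultimately show ?L unfolding digraph_iso_def by blast
qed

end

theory Submission
  imports Defs
begin

text \<open>
  Let \<open>e\<close> be an idempotent of the minimal ideal, so that \<open>eSe\<close> is a group. If \<open>e\<close> is central, it is an
  isolated vertex, because commutative semigroups are nilpotent. Otherwise, up to duality, the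
  \<open>\<L>\<close>-class of \<open>e\<close> contains an idempotent \<open>g \<noteq> e\<close>. Elements in different \<open>\<R>\<close>-classes of this
  \<open>\<L>\<close>-class are adjacent, so the absence of triangles and 4-cycles forces \<open>eSe = {e}\<close>, \<open>Se = {e, g}\<close>
  and \<open>eS = {e}\<close>. A neighbour \<open>x \<noteq> g\<close> of \<open>e\<close> then maps \<open>{e, g}\<close> constantly to \<open>g\<close> by left
  multiplication, and a neighbour \<open>y \<noteq> e\<close> of \<open>g\<close> maps it constantly to \<open>e\<close>; hence \<open>x\<close> and \<open>y\<close> are
  adjacent, and \<open>e, g, y, x\<close> is a 4-cycle.
\<close>

section \<open>Nilpotency criteria and minimal idempotents of a finite semigroup\<close>

context semigroup_on
begin

lemma gen_subsemigroup_subset: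
  assumes "A \<subseteq> S"
  shows "gen_subsemigroup f A \<subseteq> S"
proof
  fix x assume "x \<in> gen_subsemigroup f A"
  then show "x \<in> S" by induction (use assms closed in auto)
qed

text \<open>Centralizers are closed under products; this is used for each generator against
  \<open>a\<close>, then for \<open>a\<close> against \<open>b\<close>.\<close>

lemma gen_subsemigroup_commute:
  assumes "x \<in> S" "y \<in> S" "f x y = f y x"
    and "a \<in> gen_subsemigroup f {x, y}" "b \<in> gen_subsemigroup f {x, y}"
  shows "f a b = f b a"
proof -
  have sub: "\<And>t. t \<in> gen_subsemigroup f {x, y} \<Longrightarrow> t \<in> S"
    using gen_subsemigroup_subset[of "{x, y}"] assms(1,2) by auto
  have ext: "f c t = f t c"
    if "t \<in> gen_subsemigroup f {x, y}" "c \<in> S" "f c x = f x c" "f c y = f y c" for c t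
    using that(1)
  proof induction
    case (incl t)
    with that show ?case by auto
  next
    case (mult s t)
    then show ?case using sub that(2) by (metis assoc)
  qed
  have "f x a = f a x" "f y a = f a y"
    using ext assms by metis+
  then show ?thesis
    using ext[OF assms(5)] sub[OF assms(4)] by metis
qed

text \<open>Commutativity gives \<open>a z b = b z a\<close>, so \<open>n = 1\<close>
  suffices.\<close>

lemma malcev_nilpotent_if_commute:
  assumes "x \<in> S" "y \<in> S" "f x y = f y x"
  shows "malcev_nilpotent (gen_subsemigroup f {x, y}) f"
proof -
  let ?T = "gen_subsemigroup f {x, y}"
  have sub: "\<And>t. t \<in> ?T \<Longrightarrow> t \<in> S"
    using gen_subsemigroup_subset[of "{x, y}"] assms(1,2) by auto
  note comm = gen_subsemigroup_commute[OF assms]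
  have "malcev_lambda (S1_mult f) 1 (Some a) (Some b) c = malcev_rho (S1_mult f) 1 (Some a) (Some b) c"
    if "a \<in> ?T" "b \<in> ?T" "c 1 \<in> S1_carrier ?T f" for a b c
  proof (cases "c 1")
    case None
    with comm that show ?thesis by simp
  next
    case (Some z)
    with that have z: "z \<in> ?T"
      by (auto simp: S1_carrier_def split: if_splits)
    have "f (f a z) b = f b (f a z)"
      using comm gen_subsemigroup.mult that z by metis
    also have "\<dots> = f (f b z) a"
      using comm sub assoc that z by metis
    finally show ?thesis using Some by simp
  qed
  then show ?thesis
    unfolding malcev_nilpotent_def by (intro exI[of _ 1]) auto
qed

lemma Some_in_S1_carrier: "p \<in> T \<Longrightarrow> Some p \<in> S1_carrier T g"
  by (auto simp: S1_carrier_def)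

text \<open>\<open>p\<close> and \<open>q\<close> act on \<open>{u, v}\<close> as two distinct
  constant maps, and a composite of constant maps is its outermost factor. With every
  \<open>z i = p\<close>, \<open>\<lambda>\<^sub>n\<close> therefore keeps acting as
  \<open>p\<close> does and \<open>\<rho>\<^sub>n\<close> as \<open>q\<close> does.\<close>

lemma not_malcev_nilpotent_left:
  assumes T: "T \<subseteq> S" "p \<in> T" "q \<in> T"
    and uv: "u \<in> S" "v \<in> S" "u \<noteq> v"
    and act: "f p u = u" "f p v = u" "f q u = v" "f q v = v"
  shows "\<not> malcev_nilpotent T f"
proof -
  have "\<exists>l r. malcev_lambda (S1_mult f) n (Some p) (Some q) (\<lambda>_. Some p) = Some l
    \<and> malcev_rho (S1_mult f) n (Some p) (Some q) (\<lambda>_. Some p) = Some r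
    \<and> l \<in> S \<and> r \<in> S \<and> f l u = u \<and> f l v = u \<and> f r u = v \<and> f r v = v" for n
  proof (induction n)
    case 0
    then show ?case using assms by auto
  next
    case (Suc n)
    then obtain l r where "malcev_lambda (S1_mult f) n (Some p) (Some q) (\<lambda>_. Some p) = Some l"
      "malcev_rho (S1_mult f) n (Some p) (Some q) (\<lambda>_. Some p) = Some r"
      "l \<in> S" "r \<in> S" "f l u = u" "f l v = u" "f r u = v" "f r v = v" by blast
    moreover have "p \<in> S" using T by blast
    ultimately show ?case using act uv(1,2) by (simp add: closed assoc)
  qed
  then have "malcev_lambda (S1_mult f) n (Some p) (Some q) (\<lambda>_. Some p)
      \<noteq> malcev_rho (S1_mult f) n (Some p) (Some q) (\<lambda>_. Some p)" for n
    using uv(3) by (metis option.inject)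
  then show ?thesis
    unfolding malcev_nilpotent_def using T Some_in_S1_carrier by metis
qed

text \<open>Under a right action \<open>\<lambda>\<^sub>n\<close> and \<open>\<rho>\<^sub>n\<close> swap their roles at every step.\<close>

lemma not_malcev_nilpotent_right:
  assumes T: "T \<subseteq> S" "p \<in> T" "q \<in> T"
    and uv: "u \<in> S" "v \<in> S" "u \<noteq> v"
    and act: "f u p = u" "f v p = u" "f u q = v" "f v q = v"
  shows "\<not> malcev_nilpotent T f"
proof -
  have "\<exists>l r. malcev_lambda (S1_mult f) n (Some p) (Some q) (\<lambda>_. Some p) = Some l
    \<and> malcev_rho (S1_mult f) n (Some p) (Some q) (\<lambda>_. Some p) = Some r
    \<and> l \<in> S \<and> r \<in> S \<and> (f u l = u \<and> f v l = u \<and> f u r = v \<and> f v r = v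
         \<or> f u l = v \<and> f v l = v \<and> f u r = u \<and> f v r = u)" for n
  proof (induction n)
    case 0
    then show ?case using assms by auto
  next
    case (Suc n)
    then obtain l r where "malcev_lambda (S1_mult f) n (Some p) (Some q) (\<lambda>_. Some p) = Some l"
      "malcev_rho (S1_mult f) n (Some p) (Some q) (\<lambda>_. Some p) = Some r"
      and lr: "l \<in> S" "r \<in> S" and
      "f u l = u \<and> f v l = u \<and> f u r = v \<and> f v r = v
         \<or> f u l = v \<and> f v l = v \<and> f u r = u \<and> f v r = u" by blast
    moreover have "p \<in> S" using T by blast
    ultimately show ?case using act uv(1,2) by (auto simp: closed assoc[symmetric])
  qed
  then have "malcev_lambda (S1_mult f) n (Some p) (Some q) (\<lambda>_. Some p)
      \<noteq> malcev_rho (S1_mult f) n (Some p) (Some q) (\<lambda>_. Some p)" for n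
    using uv(3) by (metis option.inject)
  then show ?thesis
    unfolding malcev_nilpotent_def using T Some_in_S1_carrier by metis
qed

text \<open>For \<open>x\<close> in \<open>A\<close>, both \<open>xA\<close> and
  \<open>{y \<in> A. f x y = x}\<close> are closed. If \<open>xA = A\<close>, the second is
  nonempty. Induction applies to a proper one; if both are all of \<open>A\<close>, then
  \<open>x\<close> itself is idempotent.\<close>

lemma ex_idempotent:
  assumes "finite A" "A \<noteq> {}" "A \<subseteq> S" "\<And>x y. x \<in> A \<Longrightarrow> y \<in> A \<Longrightarrow> f x y \<in> A"
  shows "\<exists>x\<in>A. f x x = x"
  using assms
proof (induction A rule: finite_psubset_induct)
  case (psubset A)
  then obtain x where x: "x \<in> A" by blast
  let ?B = "f x ` A" and ?C = "{y \<in> A. f x y = x}"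
  have IH: "\<exists>x\<in>A. f x x = x" if "B \<subset> A" "B \<noteq> {}" "\<And>x y. x \<in> B \<Longrightarrow> y \<in> B \<Longrightarrow> f x y \<in> B" for B
    using psubset.IH[OF that(1,2)] that psubset.prems by blast
  have "f x a \<in> A" if "a \<in> A" for a using psubset.prems x that by blast
  moreover have "f (f x a) (f x b) \<in> ?B" if "a \<in> A" "b \<in> A" for a b
  proof -
    have "f (f x a) (f x b) = f x (f a (f x b))"
      using assoc closed psubset.prems(2) x that by (metis subsetD)
    then show ?thesis using psubset.prems(3) x that by simp
  qed
  ultimately show ?case
  proof (cases "?B = A")
    case True
    then have "?C \<noteq> {}" using x by (force simp: image_iff)
    moreover have "f y z \<in> ?C" if "y \<in> ?C" "z \<in> ?C" for y z
    proof -
      have "f x (f y z) = f (f x y) z" using assoc psubset.prems(2) x that by (metis (lifting) mem_Collect_eq subsetD)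
      then show ?thesis using that psubset.prems(3) by simp
    qed
    ultimately show ?thesis
      using IH[of ?C] x by (cases "?C = A") blast+
  next
    case False
    then have "?B \<subset> A" using \<open>\<And>a. a \<in> A \<Longrightarrow> f x a \<in> A\<close> by blast
    then show ?thesis
      using IH[of ?B] x \<open>\<And>a b. a \<in> A \<Longrightarrow> b \<in> A \<Longrightarrow> f (f x a) (f x b) \<in> ?B\<close> by blast
  qed
qed

text \<open>Minimality refers to the natural order on idempotents; in a finite semigroup these are
  exactly the idempotents of the minimal ideal.\<close>

definition minimal_idempotent :: "'a \<Rightarrow> bool" where
  "minimal_idempotent e \<longleftrightarrow> e \<in> S \<and> f e e = e \<and>
     (\<forall>j\<in>S. f j j = j \<longrightarrow> f e j = j \<longrightarrow> f j e = j \<longrightarrow> j = e)"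

text \<open>An idempotent with \<open>eSe\<close> of least size works: \<open>j\<close> below
  \<open>e\<close> puts \<open>jSj\<close> inside \<open>eSe\<close>, hence they are equal, so
  \<open>e\<close> is in \<open>jSj\<close> and \<open>je = e\<close>.\<close>

lemma ex_minimal_idempotent:
  assumes "finite S" "S \<noteq> {}"
  shows "\<exists>e. minimal_idempotent e"
proof -
  let ?C = "\<lambda>e. (\<lambda>x. f (f e x) e) ` S"
  obtain i where "i \<in> S" "f i i = i"
    using ex_idempotent[of S] assms closed by blast
  then obtain e where e: "e \<in> S" "f e e = e"
    and min: "\<And>j. j \<in> S \<Longrightarrow> f j j = j \<Longrightarrow> card (?C e) \<le> card (?C j)"
    using ex_has_least_nat[of "\<lambda>e. e \<in> S \<and> f e e = e" i "\<lambda>e. card (?C e)"] by blast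
  have "j = e" if j: "j \<in> S" "f j j = j" "f e j = j" "f j e = j" for j
  proof -
    have "f (f j x) j = f (f e (f (f j x) j)) e" if "x \<in> S" for x
      using j e that assoc closed by metis
    then have "?C j \<subseteq> ?C e"
      using closed j by blast
    then have "?C j = ?C e"
      using min[OF j(1,2)] assms(1) by (simp add: card_seteq)
    moreover have "e \<in> ?C e" using e by force
    ultimately obtain x where x: "x \<in> S" "e = f (f j x) j" by blast
    then have "f j e = e" using j closed assoc by metis
    then show "j = e" using j by simp
  qed
  then show ?thesis unfolding minimal_idempotent_def using e by blast
qed

end

section \<open>Passage to the opposite semigroup\<close>

lemma semigroup_on_opposite: "semigroup_on S f \<Longrightarrow> semigroup_on S (\<lambda>x y. f y x)"
  by (simp add: semigroup_on_def)

lemma gen_subsemigroup_opposite: "gen_subsemigroup (\<lambda>x y. f y x) A = gen_subsemigroup f A"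
proof (intro set_eqI iffI)
  fix x
  show "x \<in> gen_subsemigroup f A" if "x \<in> gen_subsemigroup (\<lambda>x y. f y x) A"
    using that by induction (auto intro: gen_subsemigroup.intros)
  show "x \<in> gen_subsemigroup (\<lambda>x y. f y x) A" if "x \<in> gen_subsemigroup f A"
    using that by induction (auto intro: gen_subsemigroup.incl gen_subsemigroup.mult[of _ "\<lambda>x y. f y x"])
qed

lemma minimal_idempotent_opposite:
  assumes "semigroup_on S f"
  shows "semigroup_on.minimal_idempotent S (\<lambda>x y. f y x) e \<longleftrightarrow> semigroup_on.minimal_idempotent S f e"
  unfolding semigroup_on.minimal_idempotent_def[OF assms]
    semigroup_on.minimal_idempotent_def[OF semigroup_on_opposite[OF assms]]
  by blast

lemma gen_subsemigroup_mono:
  assumes "A \<subseteq> B"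
  shows "gen_subsemigroup f A \<subseteq> gen_subsemigroup f B"
proof
  fix x assume "x \<in> gen_subsemigroup f A"
  then show "x \<in> gen_subsemigroup f B"
    by induction (use assms in \<open>auto intro: gen_subsemigroup.intros\<close>)
qed

section \<open>The minimal ideal in the absence of triangles and 4-cycles\<close>

text \<open>
  Only these properties of the upper non-nilpotent graph and of the cycle enter the argument.
  They are invariant under passing to the opposite semigroup.
\<close>

locale girth_five_semigroup = semigroup_on +
  fixes adj :: "'a \<Rightarrow> 'a \<Rightarrow> bool"
  assumes finite_S: "finite S"
    and adj_sym: "adj x y \<Longrightarrow> adj y x"
    and adj_in: "adj x y \<Longrightarrow> x \<in> S"
    and ex_other_adj: "x \<in> S \<Longrightarrow> \<exists>y. y \<noteq> w \<and> adj x y"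
    and no_triangle: "adj x y \<Longrightarrow> adj y z \<Longrightarrow> adj z x \<Longrightarrow> False"
    and no_square: "adj x y \<Longrightarrow> adj y z \<Longrightarrow> adj z t \<Longrightarrow> adj t x \<Longrightarrow> x = z \<or> y = t"
    and not_adj_if_commute: "x \<in> S \<Longrightarrow> y \<in> S \<Longrightarrow> f x y = f y x \<Longrightarrow> \<not> adj x y"
    and adj_left: "\<lbrakk>x \<in> S; y \<in> S; p \<in> gen_subsemigroup f {x, y}; q \<in> gen_subsemigroup f {x, y};
      u \<in> S; v \<in> S; u \<noteq> v; f p u = u; f p v = u; f q u = v; f q v = v\<rbrakk> \<Longrightarrow> adj x y"
    and adj_right: "\<lbrakk>x \<in> S; y \<in> S; p \<in> gen_subsemigroup f {x, y}; q \<in> gen_subsemigroup f {x, y};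
      u \<in> S; v \<in> S; u \<noteq> v; f u p = u; f v p = u; f u q = v; f v q = v\<rbrakk> \<Longrightarrow> adj x y"
begin

text \<open>This makes \<open>eSe\<close> a group: the right ideal \<open>t(eSe)\<close> is a finite
  semigroup, so it contains an idempotent, which lies below \<open>e\<close> and hence is
  \<open>e\<close>.\<close>

lemma minimal_idempotent_right_inverse:
  assumes "minimal_idempotent e" "t \<in> S" "f e t = t" "f t e = t"
  shows "\<exists>m\<in>S. f e m = m \<and> f m e = m \<and> f t m = e"
proof -
  let ?A = "{f t m | m. m \<in> S \<and> f e m = m \<and> f m e = m}"
  have e: "e \<in> S" "f e e = e" and min: "\<And>j. j \<in> S \<Longrightarrow> f j j = j \<Longrightarrow> f e j = j \<Longrightarrow> f j e = j \<Longrightarrow> j = e"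
    using assms(1) unfolding minimal_idempotent_def by blast+
  have sub: "?A \<subseteq> S" using closed assms by blast
  have "f x y \<in> ?A" if x: "x \<in> ?A" and y: "y \<in> ?A" for x y
  proof -
    obtain a b where ab: "x = f t a" "y = f t b" "a \<in> S" "b \<in> S"
      "f e a = a" "f a e = a" "f e b = b" "f b e = b"
      using x y by blast
    have "f (f t a) (f t b) = f t (f a (f t b))" "f e (f a (f t b)) = f a (f t b)"
      "f (f a (f t b)) e = f a (f t b)"
      using ab assms(2) e closed by (simp_all add: assoc flip: assoc[of e a])
    moreover have "f a (f t b) \<in> S" using ab assms closed by simp
    ultimately show ?thesis using ab by blast
  qed
  moreover have "?A \<noteq> {}" using e by blast
  moreover have "finite ?A" using sub finite_S finite_subset by blast
  ultimately obtain j where j: "j \<in> ?A" "f j j = j"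
    using ex_idempotent[of ?A] sub by blast
  then obtain m where m: "j = f t m" "m \<in> S" "f e m = m" "f m e = m" by blast
  have "f e j = j" "f j e = j" "j \<in> S"
    using m assms(2-4) e closed by (simp_all add: assoc flip: assoc[of e t])
  then show ?thesis using min j m by blast
qed

text \<open>Here \<open>t\<close> lies in a group with identity \<open>g\<close>. An idempotent
  \<open>j\<close> in \<open><t>\<close> makes \<open>ej\<close> an idempotent below
  \<open>e\<close>, so \<open>ej = e\<close> and \<open>j = gej = ge = g\<close>.\<close>

lemma minimal_idempotent_in_gen:
  assumes "minimal_idempotent e" "g \<in> S" "f g e = g" "f e g = e"
    and t: "t \<in> S" "f g t = t" "f t e = t"
  shows "g \<in> gen_subsemigroup f {t}"
proof -
  let ?T = "gen_subsemigroup f {t}"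
  have e: "e \<in> S" "f e e = e" and min: "\<And>j. j \<in> S \<Longrightarrow> f j j = j \<Longrightarrow> f e j = j \<Longrightarrow> f j e = j \<Longrightarrow> j = e"
    using assms(1) unfolding minimal_idempotent_def by blast+
  have sub: "?T \<subseteq> S" using t gen_subsemigroup_subset by simp
  have fix_T: "f g x = x \<and> f x e = x" if "x \<in> ?T" for x
    using that
  proof induction
    case (incl x)
    then show ?case using t by simp
  next
    case (mult x y)
    then have "x \<in> S" "y \<in> S" using sub by blast+
    with mult show ?case using assms(2) e by (metis assoc)
  qed
  obtain j where j: "j \<in> ?T" "f j j = j"
    using ex_idempotent[of ?T] sub finite_S finite_subset gen_subsemigroup.intros
    by (metis empty_iff insertI1)
  have jS: "j \<in> S" and gj: "f g j = j" "f j e = j" using j fix_T sub by blast+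
  have "f (f e j) (f e j) = f e j" "f e (f e j) = f e j" "f (f e j) e = f e j"
    using jS gj j e by (metis assoc closed)+
  then have "f e j = e" using min closed e jS by blast
  then have "j = g" using gj assms(2,3) e jS by (metis assoc)
  then show ?thesis using j by simp
qed

text \<open>\<open>e\<close> and \<open>g\<close> are powers of \<open>s\<close> and
  \<open>t\<close>, and by left multiplication they act on \<open>{e, g}\<close> as the constants
  \<open>e\<close> and \<open>g\<close>.\<close>

lemma adj_if_distinct_R_classes:
  assumes e: "minimal_idempotent e"
    and g: "g \<in> S" "f g e = g" "f e g = e" "g \<noteq> e"
    and s: "s \<in> S" "f e s = s" "f s e = s"
    and t: "t \<in> S" "f g t = t" "f t e = t"
  shows "adj s t"
proof -
  have ee: "e \<in> S" "f e e = e" using e unfolding minimal_idempotent_def by blast+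
  have gg: "f g g = g" using g ee by (metis assoc)
  have "e \<in> gen_subsemigroup f {s}" "g \<in> gen_subsemigroup f {t}"
    using minimal_idempotent_in_gen[OF e] g s t ee by blast+
  then have "e \<in> gen_subsemigroup f {s, t}" "g \<in> gen_subsemigroup f {s, t}"
    using gen_subsemigroup_mono[of "{s}" "{s, t}"] gen_subsemigroup_mono[of "{t}" "{s, t}"] by blast+
  then show ?thesis
    using adj_left[of s t e g e g] s t ee g gg by simp
qed

text \<open>One half of the centrality of \<open>e\<close>; the dual is the other half.\<close>

lemma minimal_idempotent_left:
  assumes "minimal_idempotent e" "s \<in> S"
  shows "f s e = f e (f s e)"
proof (rule ccontr)
  assume neq: "f s e \<noteq> f e (f s e)"
  have e: "e \<in> S" "f e e = e" using assms unfolding minimal_idempotent_def by blast+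
  let ?t = "f e (f s e)"
  have "?t \<in> S" "f e ?t = ?t" "f ?t e = ?t"
    using e assms(2) closed by (metis assoc)+
  \<comment> \<open>\<open>m\<close> inverts \<open>ese\<close> in the group \<open>eSe\<close>, so
    \<open>g = sm\<close> satisfies \<open>eg = e\<close>. \<open>k\<close> inverts
    \<open>m\<close>; it serves to show that \<open>g = e\<close> would put \<open>se = k\<close>
    into \<open>eSe\<close>.\<close>
  then obtain m where m: "m \<in> S" "f e m = m" "f m e = m" "f ?t m = e"
    using minimal_idempotent_right_inverse[OF assms(1)] by blast
  then obtain k where k: "k \<in> S" "f e k = k" "f m k = e"
    using minimal_idempotent_right_inverse[OF assms(1)] by blast
  define g where "g = f s m"
  have g: "g \<in> S" "f g e = g" "f e g = e"
    unfolding g_def using m e assms(2) closed by (metis assoc)+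
  have ge: "g \<noteq> e"
  proof
    assume "g = e"
    then have "f s e = k"
      using k m assms(2) unfolding g_def by (metis assoc)
    then show False using neq k by simp
  qed
  have gg: "f g g = g" using g e by (metis assoc)
  have trivial: "f e (f x e) = e" if x: "x \<in> S" for x
  proof -
    define h where "h = f e (f x e)"
    have h: "h \<in> S" "f e h = h" "f h e = h"
      unfolding h_def using e x closed by (metis assoc)+
    have gh: "f g h \<in> S" "f g (f g h) = f g h" "f (f g h) e = f g h"
      using g h e gg closed by (metis assoc)+
    \<comment> \<open>The 4-cycle \<open>e, g, h, gh\<close> degenerates only for
      \<open>h = e\<close>, since \<open>gh = g\<close> gives \<open>h = egh = eg = e\<close>. Thus
      \<open>eSe = {e}\<close>.\<close>
    have "adj e g" "adj h g" "adj h (f g h)" "adj e (f g h)"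
      using adj_if_distinct_R_classes[OF assms(1) g ge] h gh e g gg by blast+
    then have "e = h \<or> g = f g h"
      using no_square[of e g h "f g h"] adj_sym by blast
    then have "h = e" using g h e by (metis assoc)
    then show ?thesis unfolding h_def .
  qed
  have eg: "adj e g"
    using adj_if_distinct_R_classes[OF assms(1) g ge] e g gg by blast
  \<comment> \<open>Here \<open>xy = x(eye) = xe = x\<close>, so distinct elements of
    \<open>Se\<close> are adjacent; a third one would form a triangle with \<open>e\<close> and
    \<open>g\<close>.\<close>
  have left_zero: "f x y = x" if "x \<in> S" "y \<in> S" "f x e = x" "f y e = y" for x y
    using trivial[of y] that e by (metis assoc)
  have Se: "f x e = e \<or> f x e = g" if x: "x \<in> S" for x
  proof (rule ccontr)
    let ?x = "f x e"
    assume neither: "\<not> (?x = e \<or> ?x = g)"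
    have xe: "?x \<in> S" "f ?x e = ?x" using x e closed by (simp_all add: assoc)
    have "adj a b" if "a \<in> S" "b \<in> S" "f a e = a" "f b e = b" "a \<noteq> b" for a b
      using adj_left[of a b a b a b] left_zero that by (simp add: gen_subsemigroup.incl)
    then have "adj g ?x" "adj ?x e" using neither xe g e by metis+
    then show False using no_triangle eg by blast
  qed
  \<comment> \<open>An element \<open>k \<noteq> e\<close> of \<open>eS\<close> is adjacent to
    \<open>e\<close> through right multiplication on \<open>{k, e}\<close>, and to \<open>g\<close>
    because \<open>kg = e(kg)e = e\<close>: a triangle.\<close>
  have eS: "f e x = e" if x: "x \<in> S" for x
  proof (rule ccontr)
    let ?k = "f e x"
    assume neq: "?k \<noteq> e"
    have k: "?k \<in> S" "f e ?k = ?k" "f ?k e = e"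
      using x e closed trivial by (metis assoc)+
    have kk: "f ?k ?k = ?k" using k e by (metis assoc)
    have "adj ?k e"
      using adj_right[of ?k e ?k e ?k e] k kk neq e by (simp add: gen_subsemigroup.incl)
    moreover have "f ?k g = e"
      using trivial[of "f ?k g"] k g e closed by (metis assoc)
    then have "e \<in> gen_subsemigroup f {g, ?k}"
      using gen_subsemigroup.mult[of ?k f "{g, ?k}" g] by (simp add: gen_subsemigroup.incl)
    then have "adj g ?k"
      using adj_left[of g ?k e g e g] k g gg ge e by (simp add: gen_subsemigroup.incl)
    ultimately show False using no_triangle eg by blast
  qed
  have gS: "f g x = g" if "x \<in> S" for x
    using eS[OF that] g e that by (metis assoc)
  have Sg: "f x g = e \<or> f x g = g" if "x \<in> S" for x
    using Se[of "f x g"] g e that closed by (metis assoc)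
  \<comment> \<open>If \<open>xe = e\<close>, then \<open>x\<close> commutes with \<open>e\<close>;
    if \<open>xg = e\<close>, then \<open>e\<close> is in \<open><g, x>\<close> and
    \<open>e, g, x\<close> is a triangle.\<close>
  have other: "f x e = g \<and> f x g = g" if x: "adj e x" "x \<noteq> g" for x
  proof -
    have xS: "x \<in> S" using x adj_sym adj_in by blast
    have "f x e \<noteq> e" using not_adj_if_commute[OF e(1) xS] x eS[OF xS] by metis
    moreover have "f x g \<noteq> e"
    proof
      assume "f x g = e"
      then have "e \<in> gen_subsemigroup f {g, x}"
        using gen_subsemigroup.mult[of x f "{g, x}" g] by (simp add: gen_subsemigroup.incl)
      then have "adj g x"
        using adj_left[of g x e g e g] xS g gg ge e by (simp add: gen_subsemigroup.incl)
      then show False using no_triangle eg x adj_sym by blast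
    qed
    ultimately show ?thesis using Se Sg xS by blast
  qed
  \<comment> \<open>The same with \<open>e\<close> and \<open>g\<close> exchanged, using
    \<open>gS = {g}\<close>.\<close>
  have other': "f y e = e \<and> f y g = e" if y: "adj g y" "y \<noteq> e" for y
  proof -
    have yS: "y \<in> S" using y adj_sym adj_in by blast
    have "f y g \<noteq> g" using not_adj_if_commute[OF g(1) yS] y gS[OF yS] by metis
    moreover have "f y e \<noteq> g"
    proof
      assume "f y e = g"
      then have "g \<in> gen_subsemigroup f {e, y}"
        using gen_subsemigroup.mult[of y f "{e, y}" e] by (simp add: gen_subsemigroup.incl)
      then have "adj e y"
        using adj_left[of e y e g e g] yS g gg ge e by (simp add: gen_subsemigroup.incl)
      then show False using no_triangle eg y adj_sym by blast
    qed
    ultimately show ?thesis using Se Sg yS by blast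
  qed
  obtain x where x: "x \<noteq> g" "adj e x" using ex_other_adj e by blast
  obtain y where y: "y \<noteq> e" "adj g y" using ex_other_adj g by blast
  have "x \<in> S" "y \<in> S" using x y adj_sym adj_in by blast+
  then have "adj y x"
    using adj_left[of y x y x e g] other[OF x(2,1)] other'[OF y(2,1)] e g ge
    by (simp add: gen_subsemigroup.incl)
  \<comment> \<open>\<open>no_square\<close> would force \<open>e = y\<close> or
    \<open>g = x\<close>, both excluded by the choice of \<open>x\<close> and
    \<open>y\<close>.\<close>
  then show False using no_square[OF eg y(2)] x y adj_sym by blast
qed

text \<open>\<open>adj_left\<close> and \<open>adj_right\<close> change places; the other axioms are
  self-dual.\<close>

lemma opposite: "girth_five_semigroup S (\<lambda>x y. f y x) adj"
proof -
  interpret op: semigroup_on S "\<lambda>x y. f y x"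
    by (rule semigroup_on_opposite) (rule semigroup_on_axioms)
  show ?thesis
  proof unfold_locales
    show "\<And>x y. adj x y \<Longrightarrow> adj y x" "\<And>x y. adj x y \<Longrightarrow> x \<in> S"
      by (fact adj_sym adj_in)+
    show "\<And>x y z. adj x y \<Longrightarrow> adj y z \<Longrightarrow> adj z x \<Longrightarrow> False" by (fact no_triangle)
    show "\<And>x y z t. adj x y \<Longrightarrow> adj y z \<Longrightarrow> adj z t \<Longrightarrow> adj t x \<Longrightarrow> x = z \<or> y = t" by (fact no_square)
    show "\<And>x y p q u v. \<lbrakk>x \<in> S; y \<in> S; p \<in> gen_subsemigroup (\<lambda>x y. f y x) {x, y};
        q \<in> gen_subsemigroup (\<lambda>x y. f y x) {x, y};
        u \<in> S; v \<in> S; u \<noteq> v; f u p = u; f v p = u; f u q = v; f v q = v\<rbrakk> \<Longrightarrow> adj x y"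
      unfolding gen_subsemigroup_opposite[of f] by (fact adj_right)
    show "\<And>x y p q u v. \<lbrakk>x \<in> S; y \<in> S; p \<in> gen_subsemigroup (\<lambda>x y. f y x) {x, y};
        q \<in> gen_subsemigroup (\<lambda>x y. f y x) {x, y};
        u \<in> S; v \<in> S; u \<noteq> v; f p u = u; f p v = u; f q u = v; f q v = v\<rbrakk> \<Longrightarrow> adj x y"
      unfolding gen_subsemigroup_opposite[of f] by (fact adj_left)
  qed (use finite_S ex_other_adj not_adj_if_commute in auto)
qed

text \<open>\<open>se = ese\<close> and its dual \<open>es = ese\<close> make \<open>e\<close>
  central, hence isolated, against \<open>ex_other_adj\<close>.\<close>

lemma empty: "S = {}"
proof (rule ccontr)
  assume "S \<noteq> {}"
  then obtain e where e: "minimal_idempotent e"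
    using ex_minimal_idempotent finite_S by blast
  have eS: "e \<in> S" using e unfolding minimal_idempotent_def by blast
  interpret op: girth_five_semigroup S "\<lambda>x y. f y x" adj
    by (rule opposite)
  have "op.minimal_idempotent e"
    using e unfolding minimal_idempotent_opposite[OF semigroup_on_axioms] .
  then have "f e s = f s e" if "s \<in> S" for s
    using minimal_idempotent_left[OF e that] op.minimal_idempotent_left[of e s] that eS by (metis assoc)
  then have "\<not> adj e s" for s
    using not_adj_if_commute eS adj_in adj_sym by blast
  then show False using ex_other_adj[OF eS] by blast
qed

end

section \<open>Short cycles in the cycle graph, and the conclusion\<close>

lemma cycle_graph_arcs_iff:
  "(i, j) \<in> parcs (cycle_graph n) \<longleftrightarrow> i < n \<and> j < n \<and>
     (j = (if Suc i = n then 0 else Suc i) \<or> i = (if Suc j = n then 0 else Suc j))"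
  by (auto simp: cycle_graph_def)

lemma cycle_graph_ex_other:
  assumes "n \<ge> 3" "i < n"
  shows "\<exists>j. j \<noteq> k \<and> (i, j) \<in> parcs (cycle_graph n)"
proof -
  \<comment> \<open>Successor and predecessor on the cycle; they differ because
    \<open>n \<ge> 3\<close>, so one of them is not \<open>k\<close>.\<close>
  define a where "a = (if Suc i = n then 0 else Suc i)"
  define b where "b = (if i = 0 then n - 1 else i - 1)"
  have "(i, a) \<in> parcs (cycle_graph n)" "(i, b) \<in> parcs (cycle_graph n)" "a \<noteq> b"
    using assms by (auto simp: cycle_graph_arcs_iff a_def b_def)
  then show ?thesis by metis
qed

text \<open>Three steps of \<open>+1\<close> or \<open>-1\<close> add up to an odd number of
  absolute value at most 3, never divisible by \<open>n \<ge> 4\<close>.\<close>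

lemma cycle_graph_no_triangle:
  assumes "n \<ge> 4" "(i, j) \<in> parcs (cycle_graph n)" "(j, k) \<in> parcs (cycle_graph n)"
  shows "(k, i) \<notin> parcs (cycle_graph n)"
  using assms by (auto simp: cycle_graph_arcs_iff split: if_splits)

text \<open>Four steps of \<open>+1\<close> or \<open>-1\<close> must add up to 0, since
  \<open>n \<ge> 5\<close> divides neither 2 nor 4; hence two cyclically consecutive steps
  cancel.\<close>

lemma cycle_graph_no_square:
  assumes "n \<ge> 5" "(i, j) \<in> parcs (cycle_graph n)" "(j, k) \<in> parcs (cycle_graph n)"
    "(k, l) \<in> parcs (cycle_graph n)" "(l, i) \<in> parcs (cycle_graph n)"
  shows "i = k \<or> j = l"
  using assms by (auto simp: cycle_graph_arcs_iff split: if_splits)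

theorem theorem4p6:
  fixes S :: "'a set" and f :: "'a \<Rightarrow> 'a \<Rightarrow> 'a" and n :: nat
  assumes "semigroup_on S f"
    and "finite S"
    and "card S = n"
    and "n \<ge> 5"
  shows "\<not> digraph_iso (with_proj (upper_non_nilpotent_graph S f)) (with_proj (cycle_graph n))"
proof
  assume iso: "digraph_iso (with_proj (upper_non_nilpotent_graph S f)) (with_proj (cycle_graph n))"
  let ?G = "upper_non_nilpotent_graph S f"
  interpret semigroup_on S f by fact
  interpret G: pair_graph ?G by (rule pair_graph_upper_non_nilpotent_graph) fact
  interpret C: pair_graph "cycle_graph n" by (rule pair_graph_cycle_graph) (use assms in simp)
  obtain g where g: "bij_betw g S {0..<n}"
    and arcs: "\<And>x y. x \<in> S \<Longrightarrow> y \<in> S \<Longrightarrow> (x, y) \<in> parcs ?G \<longleftrightarrow> (g x, g y) \<in> parcs (cycle_graph n)"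
    using iso unfolding digraph_iso_with_proj_iff[OF G.pair_wf_digraph_axioms C.pair_wf_digraph_axioms]
    by (auto simp: upper_non_nilpotent_graph_def cycle_graph_def)
  define adj where "adj x y \<longleftrightarrow> (x, y) \<in> parcs ?G" for x y
  \<comment> \<open>\<open>x \<noteq> y\<close> is automatic on the right: a single element
    generates a commutative, hence nilpotent, semigroup.\<close>
  have adj_iff: "adj x y \<longleftrightarrow> x \<in> S \<and> y \<in> S \<and> \<not> malcev_nilpotent (gen_subsemigroup f {x, y}) f" for x y
    using malcev_nilpotent_if_commute[of x x] by (auto simp: adj_def upper_non_nilpotent_graph_def)
  have adjD: "x \<in> S" "y \<in> S" "(g x, g y) \<in> parcs (cycle_graph n)" if "adj x y" for x y
    using that arcs adj_iff by (auto simp: adj_def)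
  have inj: "x = y" if "g x = g y" "x \<in> S" "y \<in> S" for x y
    using g that by (meson bij_betw_def inj_onD)
  interpret girth_five_semigroup S f adj
  proof unfold_locales
    show "adj y x" if "adj x y" for x y
      using that by (simp add: adj_iff insert_commute)
    show "\<exists>y. y \<noteq> w \<and> adj x y" if x: "x \<in> S" for x w
    proof -
      have "g x < n" using g x by (auto simp: bij_betw_def)
      \<comment> \<open>Avoiding \<open>g w\<close> on the cycle avoids \<open>w\<close> in
        \<open>S\<close>, even when \<open>w\<close> lies outside \<open>S\<close>.\<close>
      then obtain j where j: "j \<noteq> g w" "(g x, j) \<in> parcs (cycle_graph n)"
        using cycle_graph_ex_other[of n "g x" "g w"] assms(4) by auto
      then have "j \<in> g ` S" using g by (auto simp: bij_betw_def cycle_graph_def)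
      then obtain y where "y \<in> S" "j = g y" by blast
      then show ?thesis using j arcs x adj_def by metis
    qed
    show False if "adj x y" "adj y z" "adj z x" for x y z
      using cycle_graph_no_triangle[of n "g x" "g y" "g z"] adjD that assms(4) by simp
    show "x = z \<or> y = t" if "adj x y" "adj y z" "adj z t" "adj t x" for x y z t
      using cycle_graph_no_square[of n "g x" "g y" "g z" "g t"] inj adjD that assms(4) by blast
    show "\<not> adj x y" if "x \<in> S" "y \<in> S" "f x y = f y x" for x y
      using malcev_nilpotent_if_commute[OF that] by (simp add: adj_iff)
    show "adj x y" if "x \<in> S" "y \<in> S" "p \<in> gen_subsemigroup f {x, y}" "q \<in> gen_subsemigroup f {x, y}"
      "u \<in> S" "v \<in> S" "u \<noteq> v" "f p u = u" "f p v = u" "f q u = v" "f q v = v" for x y p q u v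
      using not_malcev_nilpotent_left[OF gen_subsemigroup_subset] that by (simp add: adj_iff)
    show "adj x y" if "x \<in> S" "y \<in> S" "p \<in> gen_subsemigroup f {x, y}" "q \<in> gen_subsemigroup f {x, y}"
      "u \<in> S" "v \<in> S" "u \<noteq> v" "f u p = u" "f v p = u" "f u q = v" "f v q = v" for x y p q u v
      using not_malcev_nilpotent_right[OF gen_subsemigroup_subset] that by (simp add: adj_iff)
  qed (use assms adj_iff in auto)
  show False using empty assms(3,4) by simp
qed

end
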